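(* For every integer $n \ge 3$, the large rank of the semigroup $A^+(B_n)$ is $r_5(A^+(B_n)) = (n!)\,n^2 + n^4 + 2$.
   Context: Brandt semigroup. For $n\ge 1$ let $[n]=\{1,\dots,n\}$ and $B_n = ([n]\times[n])\cup\{\vartheta\}$, with the (non-commutative) operation $+$ given by $(i,j)+(k,l)=(i,l)$ if $j=k$ and $(i,j)+(k,l)=\vartheta$ otherwise, and $\vartheta+x=x+\vartheta=\vartheta$ for all $x\in B_n$. Affine maps. Arguments of functions are written on the left ($xf$ is the value of $f$ at $x$), so $x(fg)=(xf)g$. Let $M(B_n)$ be the set of all maps $B_n\to B_n$, with pointwise addition $+$ and composition. A map is affine if it equals $g+h$ with $g$ an endomorphism of $(B_n,+)$ and $h$ a constant map; $\mathrm{Aff}(B_n)$ is the set of affine maps. $A^+(B_n)$ is the smallest subset of $M(B_n)$ containing $\mathrm{Aff}(B_n)$ and closed under $+$ and composition; here it is regarded as a semigroup under composition only. Explicit description (known). For $c\in B_n$ let $\xi_c$ be the constant map with value $c$; for $k,l,p,q\in[n]$ let ${}^{(k,l)}\zeta_{(p,q)}$ be the map sending $(k,l)$ to $(p,q)$ and all other elements to $\vartheta$; for $p,q\in[n]$ and a permutation $\sigma\in S_n$ let $(p,q;\sigma)$ be the map sending $(i,p)$ to $(i\sigma,q)$ for all $i\in[n]$ and all other elements to $\vartheta$. For $n\ge 2$, $A^+(B_n)=\{(p,q;\sigma): p,q\in[n],\sigma\in S_n\}\cup\{\xi_c : c\in B_n\}\cup\{{}^{(k,l)}\zeta_{(p,q)}: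 k,l,p,q\in[n]\}$. Rank. For a finite semigroup $\Gamma$, the large rank is $r_5(\Gamma)=\min\{k : \text{every subset } U \text{ of cardinality } k \text{ in } \Gamma \text{ generates } \Gamma\}$ (generation as a semigroup). *)

theory Defs
  imports Complex_Main "HOL-Library.FuncSet"
begin

text \<open>
  The zero \<open>\<vartheta>\<close> of the Brandt semigroup is \<^const>\<open>None\<close>; the pair \<open>(i, j)\<close> is \<open>Some (i, j)\<close>.
\<close>

type_synonym brandt = "(nat \<times> nat) option"

definition brandt :: "nat \<Rightarrow> brandt set" where
  "brandt n = insert None (Some ` ({1..n} \<times> {1..n}))"

fun brandt_add :: "brandt \<Rightarrow> brandt \<Rightarrow> brandt" where
  "brandt_add (Some (i, j)) (Some (k, l)) = (if j = k then Some (i, l) else None)"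
| "brandt_add None _ = None"
| "brandt_add _ None = None"

text \<open>
  Maps \<open>B\<^sub>n \<rightarrow> B\<^sub>n\<close> are extensional functions, so that two maps are equal
  iff they agree on \<open>B\<^sub>n\<close>.
\<close>

definition brandt_maps :: "nat \<Rightarrow> (brandt \<Rightarrow> brandt) set" where
  "brandt_maps n = (brandt n \<rightarrow>\<^sub>E brandt n)"

definition map_add ::
    "nat \<Rightarrow> (brandt \<Rightarrow> brandt) \<Rightarrow> (brandt \<Rightarrow> brandt) \<Rightarrow> (brandt \<Rightarrow> brandt)" where
  "map_add n f g = (\<lambda>x\<in>brandt n. brandt_add (f x) (g x))"

text \<open>
  Arguments stand on the left, so the product \<open>f g\<close> applies \<open>f\<close> first.
\<close>

definition then_map ::
    "nat \<Rightarrow> (brandt \<Rightarrow> brandt) \<Rightarrow> (brandt \<Rightarrow> brandt) \<Rightarrow> (brandt \<Rightarrow> brandt)" where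
  "then_map n f g = compose (brandt n) g f"

definition const_map :: "nat \<Rightarrow> brandt \<Rightarrow> (brandt \<Rightarrow> brandt)" where
  "const_map n c = (\<lambda>x\<in>brandt n. c)"

definition brandt_endos :: "nat \<Rightarrow> (brandt \<Rightarrow> brandt) set" where
  "brandt_endos n = {g \<in> brandt_maps n. \<forall>x\<in>brandt n. \<forall>y\<in>brandt n.
     g (brandt_add x y) = brandt_add (g x) (g y)}"

definition affine_maps :: "nat \<Rightarrow> (brandt \<Rightarrow> brandt) set" where
  "affine_maps n = {map_add n g (const_map n c) | g c. g \<in> brandt_endos n \<and> c \<in> brandt n}"

inductive_set Aplus :: "nat \<Rightarrow> (brandt \<Rightarrow> brandt) set" for n :: nat where
  affine: "f \<in> affine_maps n \<Longrightarrow> f \<in> Aplus n"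
| add: "f \<in> Aplus n \<Longrightarrow> g \<in> Aplus n \<Longrightarrow> map_add n f g \<in> Aplus n"
| comp: "f \<in> Aplus n \<Longrightarrow> g \<in> Aplus n \<Longrightarrow> then_map n f g \<in> Aplus n"

inductive_set semigroup_generated :: "('a \<Rightarrow> 'a \<Rightarrow> 'a) \<Rightarrow> 'a set \<Rightarrow> 'a set"
  for mult :: "'a \<Rightarrow> 'a \<Rightarrow> 'a" and U :: "'a set" where
  base: "x \<in> U \<Longrightarrow> x \<in> semigroup_generated mult U"
| mult: "x \<in> semigroup_generated mult U \<Longrightarrow> y \<in> semigroup_generated mult U
    \<Longrightarrow> mult x y \<in> semigroup_generated mult U"

text \<open>
  The large rank \<open>r\<^sub>5\<close> of the semigroup with carrier \<open>S\<close> and product \<open>mult\<close>. It is meant for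
  finite \<open>S\<close>, where \<open>k = card S + 1\<close> meets the condition vacuously, so the minimum exists.
\<close>

definition large_rank :: "'a set \<Rightarrow> ('a \<Rightarrow> 'a \<Rightarrow> 'a) \<Rightarrow> nat" where
  "large_rank S mult =
     (LEAST k. \<forall>U. U \<subseteq> S \<and> card U = k \<longrightarrow> semigroup_generated mult U = S)"

end

theory Submission
  imports Defs "HOL-Combinatorics.Permutations"
begin

text \<open>
  The maps fixing \<open>\<vartheta>\<close> form a proper subsemigroup that omits only the \<open>n\<^sup>2\<close> nonzero constants.
  Conversely, suppose fewer than \<open>n\<^sup>2\<close> elements are missing from \<open>U\<close>. Every \<open>(p, q; \<sigma>)\<close> has
  \<open>n \<cdot> n!\<close> factorisations \<open>(p, r; \<alpha>) (r, q; \<alpha>\<inverse>\<sigma>)\<close>, and a missing element spoils at most two of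
  them; since \<open>n! \<ge> 2n\<close>, one factorisation survives. The \<open>(p, q; \<sigma>)\<close> then carry any constant to
  any other and any \<open>\<zeta>\<close> to any other with the same support, and each of these classes has
  \<open>n\<^sup>2\<close> elements, so \<open>U\<close> meets all of them.
\<close>

section \<open>Large rank\<close>

lemma semigroup_generated_subset:
  assumes "U \<subseteq> T" "\<And>x y. x \<in> T \<Longrightarrow> y \<in> T \<Longrightarrow> m x y \<in> T"
  shows "semigroup_generated m U \<subseteq> T"
proof
  fix x assume "x \<in> semigroup_generated m U"
  then show "x \<in> T"
    by induction (use assms in auto)
qed

text \<open>No \<open>k\<close> up to \<open>card T\<close> has the required property, because a
  \<open>k\<close>-element subset of \<open>T\<close> generates only elements of the proper
  subsemigroup \<open>T\<close>. The last assumption makes this lower bound sharp.\<close>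

lemma large_rank_eqI:
  assumes "T \<subset> S" "\<And>x y. x \<in> T \<Longrightarrow> y \<in> T \<Longrightarrow> m x y \<in> T"
    and "\<And>U. U \<subseteq> S \<Longrightarrow> card U = Suc (card T) \<Longrightarrow> semigroup_generated m U = S"
  shows "large_rank S m = Suc (card T)"
  unfolding large_rank_def
proof (rule Least_equality)
  show "\<forall>U. U \<subseteq> S \<and> card U = Suc (card T) \<longrightarrow> semigroup_generated m U = S"
    using assms(3) by blast
next
  fix k assume k: "\<forall>U. U \<subseteq> S \<and> card U = k \<longrightarrow> semigroup_generated m U = S"
  show "Suc (card T) \<le> k"
  proof (rule ccontr)
    assume "\<not> Suc (card T) \<le> k"
    then obtain U where "U \<subseteq> T" "card U = k"
      using obtain_subset_with_card_n[of k T] by auto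
    then show False
      using k assms(1) semigroup_generated_subset[of U T m] assms(2) by blast
  qed
qed

section \<open>The elements of \<open>A\<^sup>+(B\<^sub>n)\<close>\<close>

lemma None_in_brandt [simp]: "None \<in> brandt n"
  by (simp add: brandt_def)

lemma Some_in_brandt [simp]: "Some (i, j) \<in> brandt n \<longleftrightarrow> i \<in> {1..n} \<and> j \<in> {1..n}"
  by (auto simp: brandt_def)

lemma finite_brandt [simp]: "finite (brandt n)"
  by (simp add: brandt_def)

lemma brandt_cases:
  assumes "x \<in> brandt n"
  obtains "x = None" | i j where "x = Some (i, j)" "i \<in> {1..n}" "j \<in> {1..n}"
  using assms by (auto simp: brandt_def)

lemma brandt_add_None_right [simp]: "brandt_add x None = None"
  by (cases x) auto

lemma brandt_add_in_brandt:
  "x \<in> brandt n \<Longrightarrow> y \<in> brandt n \<Longrightarrow> brandt_add x y \<in> brandt n"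
  by (auto elim!: brandt_cases)

text \<open>This is the map \<open>(p, q; \<sigma>)\<close>; \<open>point_map\<close> below encodes
  the maps \<zeta> with one-point support. Both are restricted to \<open>brandt n\<close>, so that
  equality of maps is equality of functions.\<close>

definition perm_map :: "nat \<Rightarrow> nat \<Rightarrow> nat \<Rightarrow> (nat \<Rightarrow> nat) \<Rightarrow> brandt \<Rightarrow> brandt" where
  "perm_map n p q \<sigma> = (\<lambda>x\<in>brandt n. case x of None \<Rightarrow> None
     | Some (i, j) \<Rightarrow> if j = p then Some (\<sigma> i, q) else None)"

definition point_map :: "nat \<Rightarrow> brandt \<Rightarrow> brandt \<Rightarrow> brandt \<Rightarrow> brandt" where
  "point_map n c d = (\<lambda>x\<in>brandt n. if x = c then d else None)"

definition perm_maps :: "nat \<Rightarrow> (brandt \<Rightarrow> brandt) set" where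
  "perm_maps n = (\<lambda>(p, q, \<sigma>). perm_map n p q \<sigma>) ` ({1..n} \<times> {1..n} \<times> {\<sigma>. \<sigma> permutes {1..n}})"

definition point_maps :: "nat \<Rightarrow> (brandt \<Rightarrow> brandt) set" where
  "point_maps n = (\<lambda>(k, l, p, q). point_map n (Some (k, l)) (Some (p, q))) `
     ({1..n} \<times> {1..n} \<times> {1..n} \<times> {1..n})"

abbreviation const_maps :: "nat \<Rightarrow> (brandt \<Rightarrow> brandt) set" where
  "const_maps n \<equiv> const_map n ` brandt n"

lemma perm_mapsI [intro]:
  "p \<in> {1..n} \<Longrightarrow> q \<in> {1..n} \<Longrightarrow> \<sigma> permutes {1..n} \<Longrightarrow> perm_map n p q \<sigma> \<in> perm_maps n"
  unfolding perm_maps_def by (rule image_eqI[where x = "(p, q, \<sigma>)"]) simp_all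

lemma point_mapsI [intro]:
  "k \<in> {1..n} \<Longrightarrow> l \<in> {1..n} \<Longrightarrow> p \<in> {1..n} \<Longrightarrow> q \<in> {1..n} \<Longrightarrow>
     point_map n (Some (k, l)) (Some (p, q)) \<in> point_maps n"
  unfolding point_maps_def by (rule image_eqI[where x = "(k, l, p, q)"]) simp_all

lemma perm_mapsE [elim]:
  assumes "f \<in> perm_maps n"
  obtains p q \<sigma> where "f = perm_map n p q \<sigma>" "p \<in> {1..n}" "q \<in> {1..n}" "\<sigma> permutes {1..n}"
  using assms unfolding perm_maps_def by (auto simp del: atLeastAtMost_iff intro: that)

lemma point_mapsE [elim]:
  assumes "f \<in> point_maps n"
  obtains k l p q where "f = point_map n (Some (k, l)) (Some (p, q))"
    "k \<in> {1..n}" "l \<in> {1..n}" "p \<in> {1..n}" "q \<in> {1..n}"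
  using assms unfolding point_maps_def by (auto simp del: atLeastAtMost_iff intro: that)

lemma perm_map_apply [simp]:
  "perm_map n p q \<sigma> None = None"
  "i \<in> {1..n} \<Longrightarrow> j \<in> {1..n} \<Longrightarrow>
     perm_map n p q \<sigma> (Some (i, j)) = (if j = p then Some (\<sigma> i, q) else None)"
  by (auto simp: perm_map_def)

lemma point_map_apply [simp]:
  "x \<in> brandt n \<Longrightarrow> point_map n c d x = (if x = c then d else None)"
  by (auto simp: point_map_def)

lemma const_map_apply [simp]: "x \<in> brandt n \<Longrightarrow> const_map n c x = c"
  by (auto simp: const_map_def)

lemma map_add_apply [simp]: "x \<in> brandt n \<Longrightarrow> map_add n f g x = brandt_add (f x) (g x)"
  by (auto simp: map_add_def)

lemma then_map_apply [simp]: "x \<in> brandt n \<Longrightarrow> then_map n f g x = g (f x)"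
  by (auto simp: then_map_def compose_def)

lemma perm_map_extensional [simp]: "perm_map n p q \<sigma> \<in> extensional (brandt n)"
  and point_map_extensional [simp]: "point_map n c d \<in> extensional (brandt n)"
  and const_map_extensional [simp]: "const_map n c \<in> extensional (brandt n)"
  and map_add_extensional [simp]: "map_add n f g \<in> extensional (brandt n)"
  and then_map_extensional [simp]: "then_map n f g \<in> extensional (brandt n)"
  by (auto simp: perm_map_def point_map_def const_map_def map_add_def then_map_def)

lemma brandt_map_eqI:
  assumes "f \<in> extensional (brandt n)" "g \<in> extensional (brandt n)" "f None = g None"
    and "\<And>i j. i \<in> {1..n} \<Longrightarrow> j \<in> {1..n} \<Longrightarrow> f (Some (i, j)) = g (Some (i, j))"
  shows "f = g"
  using assms(1,2) by (rule extensionalityI) (auto elim!: brandt_cases simp: assms(3,4))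

lemma permutes_le:
  assumes "\<sigma> permutes {1..n}" "i \<in> {1..n}"
  shows "Suc 0 \<le> \<sigma> i" "\<sigma> i \<le> n"
  using permutes_in_image[OF assms(1), of i] assms(2) by auto

lemma permutes_inv_in:
  assumes "\<sigma> permutes A" "i \<in> A"
  shows "inv \<sigma> i \<in> A"
  using permutes_in_image[OF permutes_inv[OF assms(1)]] assms(2) by simp

lemma perm_map_in_maps:
  assumes "q \<in> {1..n}" "\<sigma> permutes {1..n}"
  shows "perm_map n p q \<sigma> \<in> brandt_maps n"
  unfolding brandt_maps_def
  using assms permutes_le[OF assms(2)]
  by (intro PiE_I) (auto elim!: brandt_cases simp: perm_map_def)

lemma point_map_in_maps: "d \<in> brandt n \<Longrightarrow> point_map n c d \<in> brandt_maps n"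
  and const_map_in_maps: "d \<in> brandt n \<Longrightarrow> const_map n d \<in> brandt_maps n"
  by (auto simp: brandt_maps_def point_map_def const_map_def)

section \<open>Endomorphisms and affine maps\<close>

text \<open>A nonzero value at \<open>None\<close> forces \<open>g\<close> to be constant. A nonzero
  element sent to \<open>None\<close> drags all others with it, since each of them is a sum
  containing it. Otherwise \<open>g\<close> is determined by its action on the idempotents
  \<open>(i, i)\<close>, which it permutes.\<close>

lemma brandt_endo_cases:
  assumes "g \<in> brandt_endos n"
  obtains (const) c where "c \<in> brandt n" "g = const_map n c"
  | (perm) \<sigma> where "\<sigma> permutes {1..n}" "g None = None"
      "\<And>i j. i \<in> {1..n} \<Longrightarrow> j \<in> {1..n} \<Longrightarrow> g (Some (i, j)) = Some (\<sigma> i, \<sigma> j)"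
proof -
  have maps: "\<And>x. x \<in> brandt n \<Longrightarrow> g x \<in> brandt n" and ext: "g \<in> extensional (brandt n)"
    and hom: "\<And>x y. x \<in> brandt n \<Longrightarrow> y \<in> brandt n \<Longrightarrow>
      g (brandt_add x y) = brandt_add (g x) (g y)"
    using assms by (auto simp: brandt_endos_def brandt_maps_def PiE_def)
  have constI: thesis if "c \<in> brandt n" "\<And>x. x \<in> brandt n \<Longrightarrow> g x = c" for c
    using const[OF that(1)] extensionalityI[OF ext const_map_extensional] that by simp
  show thesis
  proof (cases "g None")
    case (Some a)
    show thesis
    proof (rule constI[of "g None"])
      fix x assume "x \<in> brandt n"
      \<comment> \<open>\<open>None\<close> absorbs on both sides, so its image absorbs
        \<open>g x\<close> on both sides. For a nonzero image this forces \<open>g x\<close> and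
        \<open>g None\<close> to be the same idempotent.\<close>
      then have "brandt_add (g x) (g None) = g None" "brandt_add (g None) (g x) = g None"
        using hom[of x None] hom[of None x] by auto
      then show "g x = g None"
        using Some by (cases "g x"; cases a) (auto split: if_splits)
    qed (use maps in auto)
  next
    case gN: None
    show thesis
    proof (cases "\<exists>i\<in>{1..n}. \<exists>j\<in>{1..n}. g (Some (i, j)) = None")
      case True
      then obtain i j where ij: "i \<in> {1..n}" "j \<in> {1..n}" "g (Some (i, j)) = None"
        by blast
      \<comment> \<open>The element \<open>(k, l)\<close> is the sum
        \<open>(k, i) + (i, j) + (j, l)\<close>, whose middle term goes to
        \<open>None\<close>.\<close>
      have "g (Some (k, l)) = None" if "k \<in> {1..n}" "l \<in> {1..n}" for k l
        using hom[of "Some (k, i)" "Some (i, l)"] hom[of "Some (i, j)" "Some (j, l)"] ij that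
        by auto
      then show thesis
        using gN by (intro constI[of None]) (auto elim!: brandt_cases)
    next
      case False
      then have nonzero: "g (Some (i, j)) \<noteq> None" if "i \<in> {1..n}" "j \<in> {1..n}" for i j
        using that by metis
      \<comment> \<open>Idempotents go to idempotents, and the nonzero ones are exactly the diagonal
        pairs.\<close>
      have "\<exists>a. g (Some (i, i)) = Some (a, a)" if "i \<in> {1..n}" for i
        using hom[of "Some (i, i)" "Some (i, i)"] nonzero[OF that that] that
        by (cases "g (Some (i, i))") (auto split: if_splits)
      then obtain s where s: "\<And>i. i \<in> {1..n} \<Longrightarrow> g (Some (i, i)) = Some (s i, s i)"
        by metis
      have g: "g (Some (i, j)) = Some (s i, s j)" if ij: "i \<in> {1..n}" "j \<in> {1..n}" for i j
      proof -
        obtain a b where ab: "g (Some (i, j)) = Some (a, b)"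
          using nonzero[OF ij] by auto
        have "brandt_add (Some (s i, s i)) (Some (a, b)) = Some (a, b)"
          using hom[of "Some (i, i)" "Some (i, j)", symmetric] ij by (simp add: s[OF ij(1)] ab)
        then have "a = s i"
          by (cases "s i = a") simp_all
        have "brandt_add (Some (a, b)) (Some (s j, s j)) = Some (a, b)"
          using hom[of "Some (i, j)" "Some (j, j)", symmetric] ij by (simp add: s[OF ij(2)] ab)
        then have "b = s j"
          by (cases "b = s j") simp_all
        with ab \<open>a = s i\<close> show ?thesis
          by simp
      qed
      \<comment> \<open>\<open>permutes\<close> requires the identity outside \<open>{1..n}\<close>,
        where \<open>s\<close> is arbitrary.\<close>
      define \<sigma> where "\<sigma> i = (if i \<in> {1..n} then s i else i)" for i
      have "s i \<in> {1..n}" if "i \<in> {1..n}" for i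
        using maps[of "Some (i, i)"] s[OF that] that by simp
      moreover have "inj_on s {1..n}"
      proof (rule inj_onI, rule ccontr)
        fix i j assume "i \<in> {1..n}" "j \<in> {1..n}" "s i = s j" "i \<noteq> j"
        \<comment> \<open>For distinct \<open>i\<close> and \<open>j\<close> the idempotents add up
          to \<open>None\<close>, whereas equal images would have a nonzero sum.\<close>
        then show False
          using hom[of "Some (i, i)" "Some (j, j)"] gN s[of i] s[of j] by auto
      qed
      ultimately have "bij_betw s {1..n} {1..n}"
        by (simp add: endo_inj_surj image_subset_iff bij_betw_def)
      then have "bij_betw \<sigma> {1..n} {1..n}"
        by (rule bij_betw_cong[THEN iffD1, rotated]) (simp add: \<sigma>_def)
      then have "\<sigma> permutes {1..n}"
        by (rule bij_imp_permutes) (auto simp: \<sigma>_def)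
      then show thesis
        using gN g by (intro perm[of \<sigma>]) (auto simp: \<sigma>_def)
    qed
  qed
qed

lemma const_endo:
  assumes "i \<in> {1..n}"
  shows "const_map n (Some (i, i)) \<in> brandt_endos n"
  using assms by (auto simp: brandt_endos_def const_map_in_maps brandt_add_in_brandt)

lemma perm_endo:
  assumes "\<sigma> permutes {1..n}"
  shows "(\<lambda>x\<in>brandt n. map_option (map_prod \<sigma> \<sigma>) x) \<in> brandt_endos n"
  unfolding brandt_endos_def brandt_maps_def
  using permutes_le[OF assms] permutes_inj[OF assms]
  by (auto elim!: brandt_cases simp: brandt_add_in_brandt dest: injD)

text \<open>Adding the constant \<open>(k, l)\<close> to the automorphism induced by \<sigma> keeps
  only the column that \<sigma> sends to \<open>k\<close>, and puts \<open>l\<close> in the second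
  coordinate. Conversely, \<open>(p, q; \<sigma>)\<close> arises from the constant
  \<open>(\<sigma> p, q)\<close>.\<close>

lemma affine_maps_eq: "affine_maps n = perm_maps n \<union> const_maps n"
proof (intro equalityI subsetI)
  fix f assume "f \<in> affine_maps n"
  then obtain g c where f: "f = map_add n g (const_map n c)" and "g \<in> brandt_endos n" "c \<in> brandt n"
    by (auto simp: affine_maps_def)
  from this(2) show "f \<in> perm_maps n \<union> const_maps n"
  proof (cases rule: brandt_endo_cases)
    case (const d)
    then have "f = const_map n (brandt_add d c)"
      by (intro brandt_map_eqI[of _ n]) (auto simp: f)
    then show ?thesis
      using const \<open>c \<in> brandt n\<close> by (auto intro: brandt_add_in_brandt)
  next
    case (perm \<sigma>)
    from \<open>c \<in> brandt n\<close> show ?thesis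
    proof (cases rule: brandt_cases)
      case 1
      then have "f = const_map n None"
        by (intro brandt_map_eqI[of _ n]) (auto simp: f)
      then show ?thesis by auto
    next
      case (2 k l)
      have "f = perm_map n (inv \<sigma> k) l \<sigma>"
        using 2 perm by (intro brandt_map_eqI[of _ n]) (auto simp: f permutes_inverses)
      moreover have "inv \<sigma> k \<in> {1..n}"
        using 2 perm(1) by (simp only: permutes_inv_in)
      ultimately show ?thesis
        using 2 perm(1) by blast
    qed
  qed
next
  fix f assume "f \<in> perm_maps n \<union> const_maps n"
  then consider p q \<sigma> where "f = perm_map n p q \<sigma>" "p \<in> {1..n}" "q \<in> {1..n}" "\<sigma> permutes {1..n}"
    | c where "f = const_map n c" "c \<in> brandt n"
    by blast
  then show "f \<in> affine_maps n"
  proof cases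
    case 1
    have "f = map_add n (\<lambda>x\<in>brandt n. map_option (map_prod \<sigma> \<sigma>) x) (const_map n (Some (\<sigma> p, q)))"
      using 1 permutes_inj[OF 1(4)]
      by (intro brandt_map_eqI[of _ n]) (auto dest: injD)
    moreover have "Some (\<sigma> p, q) \<in> brandt n"
      using 1 permutes_le[of \<sigma> n p] by simp
    ultimately show ?thesis
      using perm_endo[OF 1(4)] unfolding affine_maps_def by blast
  next
    case 2
    from 2(2) show ?thesis
    proof (cases rule: brandt_cases)
      case 1
      have "f = map_add n (\<lambda>x\<in>brandt n. map_option (map_prod id id) x) (const_map n None)"
        using 1 2 by (intro brandt_map_eqI[of _ n]) auto
      then show ?thesis
        using perm_endo[OF permutes_id] None_in_brandt unfolding affine_maps_def by blast
    next
      case (2 k l)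
      \<comment> \<open>The idempotent \<open>(k, k)\<close> is a left identity for
        \<open>(k, l)\<close>, and its constant map is an endomorphism.\<close>
      have "f = map_add n (const_map n (Some (k, k))) (const_map n (Some (k, l)))"
        using 2 \<open>f = _\<close> by (intro brandt_map_eqI[of _ n]) auto
      moreover have "Some (k, l) \<in> brandt n"
        using 2 by simp
      ultimately show ?thesis
        using const_endo[OF 2(2)] unfolding affine_maps_def by blast
    qed
  qed
qed

section \<open>Closure of the explicit description under both operations\<close>

abbreviation explicit_maps :: "nat \<Rightarrow> (brandt \<Rightarrow> brandt) set" where
  "explicit_maps n \<equiv> perm_maps n \<union> const_maps n \<union> point_maps n"

lemma explicit_maps_in_maps: "f \<in> explicit_maps n \<Longrightarrow> f \<in> brandt_maps n"
  by (auto intro!: perm_map_in_maps const_map_in_maps point_map_in_maps)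

lemma brandt_maps_apply [simp]: "f \<in> brandt_maps n \<Longrightarrow> x \<in> brandt n \<Longrightarrow> f x \<in> brandt n"
  by (auto simp: brandt_maps_def)

lemma map_add_in_maps:
  "f \<in> brandt_maps n \<Longrightarrow> g \<in> brandt_maps n \<Longrightarrow> map_add n f g \<in> brandt_maps n"
  by (auto simp: brandt_maps_def map_add_def intro!: brandt_add_in_brandt)

lemma then_map_in_maps:
  "f \<in> brandt_maps n \<Longrightarrow> g \<in> brandt_maps n \<Longrightarrow> then_map n f g \<in> brandt_maps n"
  by (auto simp: brandt_maps_def then_map_def compose_def)

text \<open>A map with at most one nonzero value is the zero constant or a point map, according to
  its value at \<open>(k, l)\<close>. This settles most cases of the closure proofs without
  computing the result.\<close>

lemma explicit_maps_single_support:
  assumes "f \<in> brandt_maps n" "f None = None"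
    and "k \<in> {1..n}" "l \<in> {1..n}"
    and "\<And>i j. i \<in> {1..n} \<Longrightarrow> j \<in> {1..n} \<Longrightarrow> (i, j) \<noteq> (k, l) \<Longrightarrow> f (Some (i, j)) = None"
  shows "f \<in> explicit_maps n"
proof -
  have ext: "f \<in> extensional (brandt n)" and "f (Some (k, l)) \<in> brandt n"
    using assms(1,3,4) by (auto simp: brandt_maps_def PiE_def)
  from this(2) show ?thesis
  proof (cases rule: brandt_cases)
    case 1
    then have "f = const_map n None"
      using assms ext by (intro brandt_map_eqI[of _ n]) (auto, metis)
    then show ?thesis by auto
  next
    case (2 p q)
    then have "f = point_map n (Some (k, l)) (Some (p, q))"
      using assms ext by (intro brandt_map_eqI[of _ n]) auto
    then show ?thesis
      using 2 assms(3,4) by blast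
  qed
qed

lemma explicit_cases:
  assumes "f \<in> explicit_maps n"
  obtains (perm) p q \<sigma> where "f = perm_map n p q \<sigma>" "p \<in> {1..n}" "q \<in> {1..n}" "\<sigma> permutes {1..n}"
  | (const) c where "f = const_map n c" "c \<in> brandt n"
  | (point) k l p q where "f = point_map n (Some (k, l)) (Some (p, q))"
      "k \<in> {1..n}" "l \<in> {1..n}" "p \<in> {1..n}" "q \<in> {1..n}"
  using assms by (elim UnE perm_mapsE point_mapsE imageE) blast+

lemma const_None_explicit: "const_map n None \<in> explicit_maps n"
  by auto

text \<open>A sum is nonzero only where both summands are, so a point map leaves at most one point.
  If the right summand is \<open>(p, q; \<sigma>)\<close> and the left one has a fixed second
  coordinate, that coordinate must equal \<open>\<sigma> i\<close>, which fixes \<open>i\<close>. A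
  nonzero constant on the right acts on \<open>(p, q; \<sigma>)\<close> uniformly.\<close>

lemma explicit_maps_add:
  assumes f: "f \<in> explicit_maps n" and g: "g \<in> explicit_maps n"
  shows "map_add n f g \<in> explicit_maps n"
proof -
  have maps: "map_add n f g \<in> brandt_maps n"
    using assms by (intro map_add_in_maps explicit_maps_in_maps)
  from f show ?thesis
  proof (cases rule: explicit_cases)
    case (point k l p q)
    then show ?thesis
      by (intro explicit_maps_single_support[OF maps, of k l]) auto
  next
    case (const c)
    from g show ?thesis
    proof (cases rule: explicit_cases)
      case (point k l p q)
      then show ?thesis
        by (intro explicit_maps_single_support[OF maps, of k l]) auto
    next
      case (const d)
      then have "map_add n f g = const_map n (brandt_add c d)"
        using \<open>f = _\<close> by (intro brandt_map_eqI[of _ n]) auto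
      then show ?thesis
        using const \<open>c \<in> _\<close> by (auto intro: brandt_add_in_brandt)
    next
      case (perm p q \<sigma>)
      from \<open>c \<in> brandt n\<close> show ?thesis
      proof (cases rule: brandt_cases)
        case 1
        then have "map_add n f g = const_map n None"
          using \<open>f = _\<close> by (intro brandt_map_eqI[of _ n]) auto
        then show ?thesis
          using const_None_explicit by simp
      next
        case (2 k l)
        have "inv \<sigma> l \<in> {1..n}"
          using 2 perm(4) by (simp only: permutes_inv_in)
        then show ?thesis
          using 2 perm \<open>f = _\<close> permutes_inverses[OF perm(4)]
          by (intro explicit_maps_single_support[OF maps, of "inv \<sigma> l" p]) auto
      qed
    qed
  next
    case (perm p q \<sigma>)
    from g show ?thesis
    proof (cases rule: explicit_cases)
      case (point k l p' q')
      then show ?thesis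
        by (intro explicit_maps_single_support[OF maps, of k l]) auto
    next
      case (const c)
      show ?thesis
      proof (cases "\<exists>l. c = Some (q, l)")
        case True
        then obtain l where l: "c = Some (q, l)" by blast
        then have "map_add n f g = perm_map n p l \<sigma>"
          using const perm by (intro brandt_map_eqI[of _ n]) auto
        then show ?thesis
          using l const perm by auto
      next
        case False
        then have "map_add n f g = const_map n None"
          using const perm by (intro brandt_map_eqI[of _ n]; cases c) auto
        then show ?thesis
          using const_None_explicit by simp
      qed
    next
      case (perm p' q' \<tau>)
      have "inv \<tau> q \<in> {1..n}"
        using \<open>q \<in> {1..n}\<close> perm(4) by (simp only: permutes_inv_in)
      then show ?thesis
        using perm \<open>f = _\<close> \<open>p \<in> _\<close> permutes_inverses[OF perm(4)]
        by (intro explicit_maps_single_support[OF maps, of "inv \<tau> q" p]) auto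
    qed
  qed
qed

text \<open>The first factor lands in column \<open>q\<close> and the second one is nonzero only on
  column \<open>q'\<close>. The left factor acts first, hence the order in
  \<open>\<tau> \<circ> \<sigma>\<close>.\<close>

lemma perm_map_then_perm_map:
  assumes "\<sigma> permutes {1..n}" "q \<in> {1..n}"
  shows "then_map n (perm_map n p q \<sigma>) (perm_map n q' r \<tau>) =
    (if q = q' then perm_map n p r (\<tau> \<circ> \<sigma>) else const_map n None)"
  using assms permutes_le[OF assms(1)] by (intro brandt_map_eqI[of _ n]) auto

lemma then_const_map:
  "f \<in> brandt_maps n \<Longrightarrow> then_map n f (const_map n c) = const_map n c"
  by (intro brandt_map_eqI[of _ n]) simp_all

lemma const_map_then: "c \<in> brandt n \<Longrightarrow> then_map n (const_map n c) g = const_map n (g c)"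
  by (intro brandt_map_eqI[of _ n]) auto

lemma explicit_maps_then:
  assumes f: "f \<in> explicit_maps n" and g: "g \<in> explicit_maps n"
  shows "then_map n f g \<in> explicit_maps n"
proof -
  note fm = explicit_maps_in_maps[OF f] and gm = explicit_maps_in_maps[OF g]
  note maps = then_map_in_maps[OF fm gm]
  show ?thesis
  \<comment> \<open>A constant factor makes the product constant. Once these are set aside, both
    factors fix \<open>None\<close>, as the single-support argument requires.\<close>
  proof (cases "g \<in> const_maps n \<or> f \<in> const_maps n")
    case True
    then show ?thesis
      using then_const_map[OF fm] const_map_then gm by (auto simp: brandt_maps_def)
  next
    case nconst: False
    then have gN: "g None = None"
      using g by auto
    from f show ?thesis
    proof (cases rule: explicit_cases)
      case (point k l p q)
      then show ?thesis
        using gN by (intro explicit_maps_single_support[OF maps, of k l]) auto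
    next
      case (const c)
      then show ?thesis using nconst by blast
    next
      case (perm p q \<sigma>)
      from g show ?thesis
      proof (cases rule: explicit_cases)
        case (const c)
        then show ?thesis using nconst by blast
      next
        case (point k l p' q')
        \<comment> \<open>Only \<open>(inv \<sigma> k, p)\<close> can be mapped to
          \<open>(k, l)\<close> by the first factor.\<close>
        have "inv \<sigma> k \<in> {1..n}"
          using point perm(4) by (simp only: permutes_inv_in)
        then show ?thesis
          using perm point permutes_inverses[OF perm(4)] permutes_le[OF perm(4)]
          by (intro explicit_maps_single_support[OF maps, of "inv \<sigma> k" p]) auto
      next
        case (perm p' q' \<tau>)
        note f = \<open>f = _\<close> \<open>p \<in> _\<close> \<open>q \<in> _\<close> \<open>\<sigma> permutes _\<close>
        have "(\<tau> \<circ> \<sigma>) permutes {1..n}"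
          using f perm permutes_compose by blast
        then have "perm_map n p q' (\<tau> \<circ> \<sigma>) \<in> perm_maps n"
          using f perm by blast
        then show ?thesis
          using f perm const_None_explicit by (simp add: perm_map_then_perm_map)
      qed
    qed
  qed
qed

lemma Aplus_eq: "Aplus n = explicit_maps n"
proof (intro equalityI subsetI)
  fix f assume "f \<in> Aplus n"
  then show "f \<in> explicit_maps n"
  proof induction
    case (affine f)
    then show ?case unfolding affine_maps_eq by blast
  next
    case (add f g)
    then show ?case by (intro explicit_maps_add)
  next
    case (comp f g)
    then show ?case by (intro explicit_maps_then)
  qed
next
  fix f assume "f \<in> explicit_maps n"
  then show "f \<in> Aplus n"
  proof (cases rule: explicit_cases)
    case (point k l p q)
    \<comment> \<open>On column \<open>l\<close> the sum is \<open>(p, k) + (i, q)\<close>, which is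
      nonzero exactly for \<open>i = k\<close>.\<close>
    have "f = map_add n (const_map n (Some (p, k))) (perm_map n l q id)"
      using point by (intro brandt_map_eqI[of _ n]) auto
    moreover have "const_map n (Some (p, k)) \<in> affine_maps n" "perm_map n l q id \<in> affine_maps n"
      using point by (simp_all add: affine_maps_eq perm_mapsI permutes_id del: atLeastAtMost_iff)
    ultimately show ?thesis
      by (simp add: Aplus.intros)
  qed (simp_all add: Aplus.affine affine_maps_eq perm_mapsI del: atLeastAtMost_iff One_nat_def)
qed

section \<open>Counting\<close>

lemma inj_on_perm_map:
  "inj_on (\<lambda>(p, q, \<sigma>). perm_map n p q \<sigma>) ({1..n} \<times> {1..n} \<times> {\<sigma>. \<sigma> permutes {1..n}})"
proof (rule inj_onI)
  fix x y
  assume x: "x \<in> {1..n} \<times> {1..n} \<times> {\<sigma>. \<sigma> permutes {1..n}}"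
    and y: "y \<in> {1..n} \<times> {1..n} \<times> {\<sigma>. \<sigma> permutes {1..n}}"
    and eq: "(\<lambda>(p, q, \<sigma>). perm_map n p q \<sigma>) x = (\<lambda>(p, q, \<sigma>). perm_map n p q \<sigma>) y"
  obtain p q \<sigma> p' q' \<tau> where xy: "x = (p, q, \<sigma>)" "y = (p', q', \<tau>)"
    by (cases x, cases y)
  have *: "p = p' \<and> q = q' \<and> \<sigma> i = \<tau> i" if "i \<in> {1..n}" for i
    using fun_cong[OF eq, of "Some (i, p)"] x xy that by (auto split: if_splits)
  moreover have "\<sigma> i = \<tau> i" if "i \<notin> {1..n}" for i
    using permutes_not_in[of \<sigma> "{1..n}" i] permutes_not_in[of \<tau> "{1..n}" i] x y xy that by simp
  \<comment> \<open>The fact \<open>*\<close> gives \<open>p = p'\<close> and \<open>q = q'\<close>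
    only through some index in \<open>{1..n}\<close>; \<open>p\<close> itself supplies one.\<close>
  moreover have "p \<in> {1..n}"
    using x xy by simp
  ultimately show "x = y"
    using xy by blast
qed

lemma card_perm_maps: "card (perm_maps n) = fact n * n ^ 2"
  unfolding perm_maps_def card_image[OF inj_on_perm_map]
  by (simp add: card_cartesian_product card_permutations power2_eq_square)

lemma finite_perm_maps: "finite (perm_maps n)"
  unfolding perm_maps_def by (simp add: finite_permutations)

lemma inj_on_point_map:
  "inj_on (\<lambda>(k, l, p, q). point_map n (Some (k, l)) (Some (p, q)))
     ({1..n} \<times> {1..n} \<times> {1..n} \<times> {1..n})"
proof (rule inj_onI)
  let ?f = "\<lambda>(k, l, p, q). point_map n (Some (k, l)) (Some (p, q))"
  fix x y
  assume x: "x \<in> {1..n} \<times> {1..n} \<times> {1..n} \<times> {1..n}" and eq: "?f x = ?f y"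
  obtain k l p q k' l' p' q' where xy: "x = (k, l, p, q)" "y = (k', l', p', q')"
    by (cases x, cases y)
  show "x = y"
    using fun_cong[OF eq, of "Some (k, l)"] x xy by (auto split: if_splits)
qed

lemma card_point_maps: "card (point_maps n) = n ^ 4"
  unfolding point_maps_def card_image[OF inj_on_point_map]
  by (simp add: card_cartesian_product power4_eq_xxxx algebra_simps)

lemma finite_point_maps: "finite (point_maps n)"
  unfolding point_maps_def by simp

lemma inj_const_map: "inj (const_map n)"
proof (rule injI)
  fix c d assume "const_map n c = const_map n d"
  from fun_cong[OF this, of None] show "c = d" by simp
qed

text \<open>The maps that move \<open>None\<close> are the nonzero constants. Splitting them off
  isolates the subsemigroup on which the lower bound rests.\<close>

lemma Aplus_decomp:
  "Aplus n = {f \<in> Aplus n. f None = None} \<union> (\<lambda>(a, b). const_map n (Some (a, b))) ` ({1..n} \<times> {1..n})"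
  by (auto simp: Aplus_eq elim!: brandt_cases)

lemma Aplus_None_eq:
  "{f \<in> Aplus n. f None = None} = perm_maps n \<union> point_maps n \<union> {const_map n None}"
  by (auto simp: Aplus_eq)

lemma finite_Aplus: "finite (Aplus n)"
  using finite_perm_maps finite_point_maps by (simp add: Aplus_eq)

lemma card_Aplus_None:
  assumes "n \<ge> 2"
  shows "card {f \<in> Aplus n. f None = None} = fact n * n ^ 2 + n ^ 4 + 1"
proof -
  have "perm_map n p q \<sigma> \<noteq> point_map n (Some (k, l)) (Some (p', q'))"
    if A: "p \<in> {1..n}" for p q \<sigma> k l p' q'
  proof
    assume "perm_map n p q \<sigma> = point_map n (Some (k, l)) (Some (p', q'))"
    \<comment> \<open>For \<open>n \<ge> 2\<close> the map \<open>(p, q; \<sigma>)\<close> is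
      nonzero at the two points \<open>(1, p)\<close> and \<open>(2, p)\<close>, a point map at no
      more than one.\<close>
    from fun_cong[OF this, of "Some (1, p)"] fun_cong[OF this, of "Some (2, p)"] show False
      using A assms by (auto split: if_splits)
  qed
  then have 1: "perm_maps n \<inter> point_maps n = {}"
    by (metis disjoint_iff perm_mapsE point_mapsE)
  have "perm_map n p q \<sigma> \<noteq> const_map n None" if A: "p \<in> {1..n}" for p q \<sigma>
  proof
    assume "perm_map n p q \<sigma> = const_map n None"
    from fun_cong[OF this, of "Some (1, p)"] show False
      using A by auto
  qed
  moreover have "point_map n (Some (k, l)) (Some (p, q)) \<noteq> const_map n None"
    if A: "k \<in> {1..n}" "l \<in> {1..n}" for k l p q
  proof
    assume "point_map n (Some (k, l)) (Some (p, q)) = const_map n None"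
    from fun_cong[OF this, of "Some (k, l)"] show False
      using A by auto
  qed
  ultimately have 2: "const_map n None \<notin> perm_maps n \<union> point_maps n"
    by (metis UnE perm_mapsE point_mapsE)
  show ?thesis
    unfolding Aplus_None_eq
    using 2 card_Un_disjoint[OF finite_perm_maps finite_point_maps 1]
      finite_perm_maps[of n] finite_point_maps[of n]
    by (simp add: card_perm_maps card_point_maps)
qed

lemma card_Aplus:
  assumes "n \<ge> 2"
  shows "card (Aplus n) = fact n * n ^ 2 + n ^ 4 + 1 + n ^ 2"
proof -
  let ?C = "(\<lambda>(a, b). const_map n (Some (a, b))) ` ({1..n} \<times> {1..n})"
  have "card ?C = n ^ 2"
    by (subst card_image)
      (auto intro!: inj_onI dest!: injD[OF inj_const_map] simp: power2_eq_square)
  moreover have "{f \<in> Aplus n. f None = None} \<inter> ?C = {}"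
    by auto
  moreover have "finite {f \<in> Aplus n. f None = None}"
    using finite_Aplus by simp
  ultimately show ?thesis
    using card_Aplus_None[OF assms]
    by (subst Aplus_decomp, subst card_Un_disjoint) simp_all
qed

text \<open>Equality holds at \<open>n = 3\<close>, and the inequality fails at
  \<open>n = 2\<close>. It makes the \<open>n * fact n\<close> factorisations outnumber those spoilt
  by missing elements.\<close>

lemma fact_ge_double:
  assumes "n \<ge> 3"
  shows "(fact n :: nat) \<ge> 2 * n"
  using assms
proof (induction n rule: dec_induct)
  case base
  show ?case by (simp add: numeral_eq_Suc)
next
  case (step n)
  have "2 * Suc n \<le> fact n * Suc n"
    using step by (intro mult_right_mono) auto
  then show ?case by (simp add: algebra_simps)
qed

section \<open>Generation\<close>

lemma perm_map_generated:
  assumes n: "n \<ge> 3" and "finite M" "card M < n ^ 2"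
    and U: "Aplus n - M \<subseteq> U"
    and pq: "p \<in> {1..n}" "q \<in> {1..n}" and \<sigma>: "\<sigma> permutes {1..n}"
  shows "perm_map n p q \<sigma> \<in> semigroup_generated (then_map n) U"
proof -
  let ?P = "{1..n} \<times> {\<alpha>. \<alpha> permutes {1..n}}"
  define f where "f = (\<lambda>(r, \<alpha>). perm_map n p r \<alpha>)"
  define g where "g = (\<lambda>(r, \<alpha>). perm_map n r q (\<sigma> \<circ> inv \<alpha>))"
  \<comment> \<open>The factorisations spoilt by their left factor and by their right factor. Each
    factor determines the pair \<open>(r, \<alpha>)\<close>, so either set has at most
    \<open>card M\<close> elements.\<close>
  let ?A = "{x \<in> ?P. f x \<in> M}" and ?B = "{x \<in> ?P. g x \<in> M}"
  note eqD = inj_onD[OF inj_on_perm_map, of n "(_, _, _)" "(_, _, _)", simplified]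
  have perm: "(\<sigma> \<circ> inv \<alpha>) permutes {1..n}" if "\<alpha> permutes {1..n}" for \<alpha>
    using that \<sigma> by (simp add: permutes_compose permutes_inv)
  have "inj_on f ?A"
    using pq by (intro inj_onI) (auto simp: f_def dest!: eqD)
  then have A: "card ?A \<le> card M"
    by (rule card_inj_on_le) (use \<open>finite M\<close> in auto)
  have "\<alpha> = \<beta>" if "\<sigma> \<circ> inv \<alpha> = \<sigma> \<circ> inv \<beta>" "\<alpha> permutes {1..n}" "\<beta> permutes {1..n}" for \<alpha> \<beta>
  proof -
    have "inv \<sigma> \<circ> (\<sigma> \<circ> inv \<alpha>) = inv \<sigma> \<circ> (\<sigma> \<circ> inv \<beta>)"
      using that by simp
    then have "inv \<alpha> = inv \<beta>"
      by (simp add: comp_assoc[symmetric] permutes_inv_o[OF \<sigma>])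
    then show ?thesis
      using that by (metis permutes_inv_inv)
  qed
  then have "inj_on g ?B"
    using pq perm by (intro inj_onI) (auto simp: g_def dest!: eqD)
  then have B: "card ?B \<le> card M"
    by (rule card_inj_on_le) (use \<open>finite M\<close> in auto)
  have "2 * n ^ 2 \<le> n * fact n"
    using fact_ge_double[OF n] by (simp add: power2_eq_square)
  \<comment> \<open>The strict bound on \<open>card M\<close> gives a total of fewer than
    \<open>2 * n ^ 2\<close> spoilt pairs.\<close>
  then have "card ?P > card ?A + card ?B"
    using A B \<open>card M < n ^ 2\<close> by (simp add: card_permutations card_cartesian_product)
  then have "?P \<noteq> ?A \<union> ?B"
    using card_Un_le[of ?A ?B] by (metis (no_types, lifting) linorder_not_le)
  then obtain r \<alpha> where r: "r \<in> {1..n}" "\<alpha> permutes {1..n}" "f (r, \<alpha>) \<notin> M" "g (r, \<alpha>) \<notin> M"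
    by blast
  have "f (r, \<alpha>) \<in> Aplus n" "g (r, \<alpha>) \<in> Aplus n"
    using r(1,2) perm[OF r(2)] pq
    by (simp_all add: Aplus_eq f_def g_def perm_mapsI del: atLeastAtMost_iff)
  with r have "f (r, \<alpha>) \<in> U" "g (r, \<alpha>) \<in> U"
    using U by blast+
  moreover have "then_map n (f (r, \<alpha>)) (g (r, \<alpha>)) = perm_map n p q \<sigma>"
    using r by (simp add: f_def g_def perm_map_then_perm_map comp_assoc permutes_inv_o)
  ultimately show ?thesis
    by (metis semigroup_generated.intros)
qed

section \<open>Reaching the constants and point maps\<close>

lemma ex_permutes_maps:
  assumes "a \<in> A" "b \<in> A"
  obtains \<sigma> where "\<sigma> permutes A" "\<sigma> a = b"
  using permutes_swap_id[OF assms] by (metis transpose_apply_first)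

lemma inj_image_not_subset:
  assumes "inj_on h X" "finite M" "card M < card X"
  obtains x where "x \<in> X" "h x \<notin> M"
  using assms card_inj_on_le[of h X M] by (metis image_subsetI not_le)

lemma Aplus_generated:
  assumes n: "n \<ge> 3" and U: "U \<subseteq> Aplus n" and card: "card (Aplus n - U) < n ^ 2"
  shows "semigroup_generated (then_map n) U = Aplus n"
proof
  show "semigroup_generated (then_map n) U \<subseteq> Aplus n"
    using U by (rule semigroup_generated_subset) (rule Aplus.comp)
next
  let ?G = "semigroup_generated (then_map n) U" and ?M = "Aplus n - U"
    and ?Q = "{1..n} \<times> {1..n}"
  have fin: "finite ?M"
    using finite_Aplus by simp
  have cardQ: "card ?M < card ?Q"
    using card by (simp add: card_cartesian_product power2_eq_square)
  have perm_gen: "perm_map n p q \<sigma> \<in> ?G"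
    if "p \<in> {1..n}" "q \<in> {1..n}" "\<sigma> permutes {1..n}" for p q \<sigma>
    using perm_map_generated[OF n fin card _ that] by blast
  show "Aplus n \<subseteq> ?G"
  proof
    fix f assume "f \<in> Aplus n"
    then have "f \<in> explicit_maps n"
      by (simp only: Aplus_eq)
    then show "f \<in> ?G"
    proof (cases rule: explicit_cases)
      case (perm p q \<sigma>)
      then show ?thesis using perm_gen by blast
    next
      case (point k l p q)
      \<comment> \<open>The support stays at \<open>(k, l)\<close> and only the value varies. This
        gives \<open>n ^ 2\<close> maps, too many for all to be missing.\<close>
      define h where "h = (\<lambda>(a, b). point_map n (Some (k, l)) (Some (a, b)))"
      have "inj_on h ?Q"
        unfolding h_def using point
        by (intro inj_onI) (auto dest!: fun_cong[where x = "Some (k, l)"])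
      then obtain a b where ab: "a \<in> {1..n}" "b \<in> {1..n}" "h (a, b) \<notin> ?M"
        using fin cardQ by (metis inj_image_not_subset mem_Sigma_iff surj_pair)
      moreover have "h (a, b) \<in> Aplus n"
        using ab point by (simp add: Aplus_eq h_def point_mapsI del: atLeastAtMost_iff)
      ultimately have "h (a, b) \<in> ?G"
        by (blast intro: semigroup_generated.base)
      moreover obtain \<sigma> where \<sigma>: "\<sigma> permutes {1..n}" "\<sigma> a = p"
        by (rule ex_permutes_maps[OF ab(1) point(4)])
      \<comment> \<open>The right factor takes the value \<open>(a, b)\<close> to
        \<open>(\<sigma> a, q)\<close>, which is \<open>(p, q)\<close>.\<close>
      moreover have "then_map n (h (a, b)) (perm_map n b q \<sigma>) = f"
        using ab \<sigma> point by (intro brandt_map_eqI[of _ n]) (auto simp: h_def)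
      ultimately show ?thesis
        using perm_gen ab point by (metis semigroup_generated.mult)
    next
      case (const c)
      from const(2) show ?thesis
      proof (cases rule: brandt_cases)
        case 1
        \<comment> \<open>The inner columns \<open>1\<close> and \<open>2\<close> differ, so the
          product vanishes everywhere.\<close>
        have "then_map n (perm_map n 1 1 id) (perm_map n 2 1 id) = f"
          using n const 1 by (subst perm_map_then_perm_map) (auto simp: permutes_id)
        moreover have "perm_map n 1 1 id \<in> ?G" "perm_map n 2 1 id \<in> ?G"
          using n by (auto intro!: perm_gen permutes_id)
        ultimately show ?thesis
          by (metis semigroup_generated.mult)
      next
        case (2 p q)
        define h where "h = (\<lambda>(a, b). const_map n (Some (a, b)))"
        have "inj_on h ?Q"
          unfolding h_def by (auto intro!: inj_onI dest!: injD[OF inj_const_map])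
        then obtain a b where ab: "a \<in> {1..n}" "b \<in> {1..n}" "h (a, b) \<notin> ?M"
          using fin cardQ by (metis inj_image_not_subset mem_Sigma_iff surj_pair)
        moreover have "h (a, b) \<in> Aplus n"
          unfolding Aplus_eq h_def using ab by simp
        ultimately have "h (a, b) \<in> ?G"
          by (blast intro: semigroup_generated.base)
        moreover obtain \<sigma> where \<sigma>: "\<sigma> permutes {1..n}" "\<sigma> a = p"
          by (rule ex_permutes_maps[OF ab(1) 2(2)])
        moreover have "then_map n (h (a, b)) (perm_map n b q \<sigma>) = f"
          using ab \<sigma> const 2 by (simp add: h_def const_map_then)
        ultimately show ?thesis
          using perm_gen ab 2 by (metis semigroup_generated.mult)
      qed
    qed
  qed
qed

theorem theorem5p5:
  fixes n :: nat
  assumes "n \<ge> 3"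
  shows "large_rank (Aplus n) (then_map n) = fact n * n ^ 2 + n ^ 4 + 2"
proof -
  let ?T = "{f \<in> Aplus n. f None = None}"
  have card: "card ?T = fact n * n ^ 2 + n ^ 4 + 1"
    using assms by (intro card_Aplus_None) simp
  have "large_rank (Aplus n) (then_map n) = Suc (card ?T)"
  proof (rule large_rank_eqI)
    have "const_map n (Some (1, 1)) \<in> Aplus n - ?T"
      using assms by (simp add: Aplus_eq)
    then show "?T \<subset> Aplus n" by blast
  next
    fix f g assume "f \<in> ?T" "g \<in> ?T"
    then show "then_map n f g \<in> ?T"
      by (auto intro: Aplus.comp)
  next
    fix U assume U: "U \<subseteq> Aplus n" "card U = Suc (card ?T)"
    \<comment> \<open>\<open>Aplus n\<close> exceeds \<open>?T\<close> by \<open>n ^ 2\<close>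
      elements and \<open>U\<close> exceeds it in size by one, so exactly \<open>n ^ 2 - 1\<close>
      elements are missing.\<close>
    have "card (Aplus n - U) < n ^ 2"
      using U card card_Aplus[of n] assms finite_Aplus finite_subset
      by (subst card_Diff_subset) auto
    then show "semigroup_generated (then_map n) U = Aplus n"
      using assms U(1) by (intro Aplus_generated)
  qed
  then show ?thesis
    by (simp add: card)
qed

end
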